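(* Let $A\in\mathbb{R}^{n\times n}$ be symmetric positive definite with largest eigenvalue $\lambda_1$ and smallest eigenvalue $\lambda_n$, let $b\in\mathbb{R}^n$, and let $f(x)=\tfrac12 x^TAx-x^Tb$ with unique minimizer $x^*=A^{-1}b$. Fix $\ell\in\{0,\tfrac12,1,\tfrac32,2,\tfrac52,3,\dots\}$ and $\omega\in(0,2)$. Given an initial point $x_0\in\mathbb{R}^n$, let $(x_k)_{k\ge 0}$ be the iterates of the Relaxed $\ell$-Minimal Gradient Descent method with relaxation parameter $\omega$, with associated vectors $g_k=Ax_k-b$ and $y_k=A^{\ell}g_k$. Define $$c(\omega):=1-\omega(2-\omega)\frac{4\lambda_1\lambda_n}{(\lambda_1+\lambda_n)^2}.$$ Then, for all $k\ge 0$, $$\|g_k\|_{A^{2\ell-1}}^2\le (c(\omega))^k\,\|g_0\|_{A^{2\ell-1}}^2,$$ $$\|x_k-x^*\|_{A^{2\ell+1}}^2\le (c(\omega))^k\,\|x_0-x^*\|_{A^{2\ell+1}}^2,$$ and $$\|y_k\|_{A^{-1}}^2\le (c(\omega))^k\,\|y_0\|_{A^{-1}}^2.$$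
   Context: For a symmetric positive definite $B\in\mathbb{R}^{n\times n}$, $\|v\|_B:=\sqrt{v^TBv}$ for $v\in\mathbb{R}^n$. Half-integer powers of $A$ are defined through its unique positive definite square root $A^{1/2}$, and $A^0=I$. Relaxed $\ell$-Minimal Gradient Descent method (with relaxation parameter $\omega$): from $x_0\in\mathbb{R}^n$, for $k\ge 0$ set $g_k=\nabla f(x_k)=Ax_k-b$, $y_k=A^{\ell}g_k$, $\alpha_k=\dfrac{y_k^Ty_k}{y_k^TAy_k}$, and $x_{k+1}=x_k-\omega\alpha_k g_k$. If $g_k=0$ (so $x_k=x^*$), the step is taken to be zero, i.e. $\alpha_k:=0$ and $x_{k+1}=x_k$. *)

theory Defs
  imports "HOL-Analysis.Analysis"
begin

definition sym_pos_def :: "real^'n^'n \<Rightarrow> bool" where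
  "sym_pos_def A \<longleftrightarrow> transpose A = A \<and> (\<forall>v. v \<noteq> 0 \<longrightarrow> 0 < v \<bullet> (A *v v))"

definition eigenvalue :: "real^'n^'n \<Rightarrow> real \<Rightarrow> bool" where
  "eigenvalue A \<mu> \<longleftrightarrow> (\<exists>v. v \<noteq> 0 \<and> A *v v = \<mu> *\<^sub>R v)"

(* The type class power on vectors is componentwise, so matrix powers are defined via **. *)

primrec mat_pow :: "real^'n^'n \<Rightarrow> nat \<Rightarrow> real^'n^'n" where
  "mat_pow A 0 = mat 1"
| "mat_pow A (Suc m) = A ** mat_pow A m"

definition mat_powi :: "real^'n^'n \<Rightarrow> int \<Rightarrow> real^'n^'n" where
  "mat_powi A j = (if 0 \<le> j then mat_pow A (nat j) else mat_pow (matrix_inv A) (nat (- j)))"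

(* Meaningful for symmetric positive definite A, where the square root exists and is unique. *)

definition mat_sqrt :: "real^'n^'n \<Rightarrow> real^'n^'n" where
  "mat_sqrt A = (THE S. sym_pos_def S \<and> S ** S = A)"

(* A^r for 2 * r an integer: the ordinary power for integer r, and the (2 * r)-th power of
   A^(1/2) otherwise. For any other r the value is irrelevant. *)

definition mat_hpow :: "real^'n^'n \<Rightarrow> real \<Rightarrow> real^'n^'n" where
  "mat_hpow A r =
    (if r \<in> \<int> then mat_powi A \<lfloor>r\<rfloor> else mat_powi (mat_sqrt A) \<lfloor>2 * r\<rfloor>)"

definition mat_norm :: "real^'n^'n \<Rightarrow> real^'n \<Rightarrow> real" where
  "mat_norm B v = sqrt (v \<bullet> (B *v v))"

definition quad_obj :: "real^'n^'n \<Rightarrow> real^'n \<Rightarrow> real^'n \<Rightarrow> real" where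
  "quad_obj A b x = 1 / 2 * (x \<bullet> (A *v x)) - x \<bullet> b"

lemma sym_inner_commute:
  assumes "transpose (A :: real^'n^'n) = A"
  shows "u \<bullet> (A *v v) = v \<bullet> (A *v u)"
  by (metis assms dot_lmul_matrix inner_commute transpose_matrix_vector)

lemma gderiv_quad_obj:
  assumes "sym_pos_def A"
  shows "GDERIV (quad_obj A b) x :> (A *v x - b)"
proof -
  have T: "transpose A = A" using assms by (simp add: sym_pos_def_def)
  have "(quad_obj A b has_derivative
      (\<lambda>h. 1 / 2 * (x \<bullet> (A *v h) + h \<bullet> (A *v x)) - h \<bullet> b)) (at x)"
    unfolding quad_obj_def
    by (auto intro!: derivative_eq_intros bounded_linear_imp_has_derivative
        matrix_vector_mul_bounded_linear)
  moreover have "(\<lambda>h. 1 / 2 * (x \<bullet> (A *v h) + h \<bullet> (A *v x)) - h \<bullet> b)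
      = (\<lambda>h. h \<bullet> (A *v x - b))"
    by (simp add: sym_inner_commute[OF T, of x] inner_diff_right)
  ultimately show ?thesis by (simp add: gderiv_def)
qed

lemma quad_obj_diff:
  assumes "transpose A = A" "A *v x = b"
  shows "quad_obj A b y - quad_obj A b x = 1 / 2 * ((y - x) \<bullet> (A *v (y - x)))"
proof -
  have "y \<bullet> (A *v x) = x \<bullet> (A *v y)" by (rule sym_inner_commute[OF assms(1)])
  then show ?thesis
    by (simp add: quad_obj_def flip: assms(2))
       (simp add: matrix_vector_mult_diff_distrib inner_diff_left inner_diff_right field_simps)
qed

lemma is_arg_min_quad_obj_iff:
  assumes "sym_pos_def A"
  shows "is_arg_min (quad_obj A b) (\<lambda>_. True) x \<longleftrightarrow> x = matrix_inv A *v b"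
proof -
  have T: "transpose A = A" and P: "\<And>v. v \<noteq> 0 \<Longrightarrow> 0 < v \<bullet> (A *v v)"
    using assms by (auto simp: sym_pos_def_def)
  have "\<forall>v. A *v v = 0 \<longrightarrow> v = 0" by (metis P inner_zero_right less_irrefl)
  then have "invertible A"
    by (simp add: invertible_left_inverse matrix_left_invertible_ker)
  then have "A ** matrix_inv A = mat 1" 
    unfolding matrix_inv_def invertible_def by (metis (mono_tags, lifting) someI_ex)
  define z where "z = matrix_inv A *v b"
  have z: "A *v z = b"
    using \<open>A ** matrix_inv A = mat 1\<close> by (simp add: z_def matrix_vector_mul_assoc)
  have "quad_obj A b z < quad_obj A b y" if "y \<noteq> z" for y
    using quad_obj_diff[OF T z, of y] P[of "y - z"] that by simp
  then show ?thesis unfolding z_def[symmetric] is_arg_min_def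
    by (metis less_asym less_irrefl)
qed

end

theory Submission
  imports Defs
begin

text \<open>With \<open>M = A\<^sup>l\<close>, which is symmetric, commutes with \<open>A\<close> and satisfies \<open>M\<^sup>2 = A\<^sup>2\<^sup>l\<close>, put
  \<open>z\<^sub>k = M (x\<^sub>k - x*)\<close>. Then \<open>y\<^sub>k = A z\<^sub>k\<close> and all three squared norms equal \<open>z\<^sub>k \<bullet> A z\<^sub>k\<close>. A step is
  \<open>z' = z - \<omega> \<alpha> y\<close>, which lowers this quantity by \<open>\<omega> (2 - \<omega>) (y \<bullet> y)\<^sup>2 / (y \<bullet> A y)\<close>, and Kantorovich's
  inequality bounds the decrease from below. Both Kantorovich's inequality and the square root of
  \<open>A\<close> come from an orthonormal eigenbasis, obtained by maximising the Rayleigh quotient.\<close>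

section \<open>Spectral theorem for self-adjoint operators and symmetric matrices\<close>

text \<open>A maximiser \<open>v\<close> of the Rayleigh quotient on the unit sphere of
  \<open>W\<close> works: by invariance its residual \<open>w\<close> lies in \<open>W\<close>, so
  \<open>w\<close> is an admissible direction, and stationarity along \<open>w\<close> forces
  \<open>w \<bullet> w = 0\<close>. Allowing any invariant \<open>W\<close> lets eigenvectors be
  added one at a time.\<close>

lemma selfadjoint_eigenvector_in_invariant_subspace:
  fixes f :: "'a::euclidean_space \<Rightarrow> 'a"
  assumes lin: "linear f" and sa: "\<And>u v. u \<bullet> f v = v \<bullet> f u"
    and W: "subspace W" and inv: "\<And>w. w \<in> W \<Longrightarrow> f w \<in> W" and nz: "W \<noteq> {0}"
  shows "\<exists>v\<in>W. norm v = 1 \<and> f v = (v \<bullet> f v) *\<^sub>R v"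
proof -
  let ?K = "W \<inter> sphere 0 1"
  have "compact ?K"
    using closed_subspace[OF W] by (simp add: closed_Int_compact)
  moreover have "?K \<noteq> {}"
  proof -
    obtain u where u: "u \<in> W" "u \<noteq> 0" using nz subspace_0[OF W] by blast
    then have "(1 / norm u) *\<^sub>R u \<in> ?K" using W by (simp add: subspace_scale)
    then show ?thesis by blast
  qed
  moreover have "continuous_on ?K (\<lambda>v. v \<bullet> f v)"
    by (intro continuous_intros linear_continuous_on linear_conv_bounded_linear[THEN iffD1, OF lin])
  ultimately obtain v where v: "v \<in> ?K" and vmax: "\<And>u. u \<in> ?K \<Longrightarrow> u \<bullet> f u \<le> v \<bullet> f v"
    using continuous_attains_sup[of ?K "\<lambda>v. v \<bullet> f v"] by blast
  define \<mu> where "\<mu> = v \<bullet> f v"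
  have vW: "v \<in> W" and vn: "norm v = 1" using v by auto
  have vv: "v \<bullet> v = 1" using vn by (simp add: norm_eq_1)
  have ray: "w \<bullet> f w \<le> \<mu> * (w \<bullet> w)" if "w \<in> W" for w
  proof (cases "w = 0")
    case True then show ?thesis by simp
  next
    case False
    let ?u = "(1 / norm w) *\<^sub>R w"
    have "?u \<in> ?K" using False that W by (simp add: subspace_scale)
    from vmax[OF this] have "(w \<bullet> f w) / (norm w)\<^sup>2 \<le> \<mu>"
      by (simp add: \<mu>_def linear_scale[OF lin] power2_eq_square)
    then show ?thesis using False by (simp add: pos_divide_le_eq dot_square_norm)
  qed
  define w where "w = f v - \<mu> *\<^sub>R v"
  define p where "p = 2 * (w \<bullet> w)"
  define q where "q = \<mu> * (w \<bullet> w) - w \<bullet> f w"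
  have wW: "w \<in> W" unfolding w_def using inv vW W by (simp add: subspace_diff subspace_scale)
  have q0: "q \<ge> 0" using ray[OF wW] by (simp add: q_def)
  \<comment> \<open>First variation: the quadratic form \<open>\<mu> |u|\<^sup>2 - u \<bullet> f u\<close> is nonnegative on \<open>W\<close> and vanishes at \<open>v\<close>.\<close>
  have quad: "t * t * q - t * p \<ge> 0" for t
  proof -
    have "v + t *\<^sub>R w \<in> W" using vW wW W by (simp add: subspace_add subspace_scale)
    note le = ray[OF this]
    have f: "(v + t *\<^sub>R w) \<bullet> f (v + t *\<^sub>R w) = \<mu> + 2 * t * (w \<bullet> f v) + t * t * (w \<bullet> f w)"
      using sa[of v w]
      by (simp add: linear_add[OF lin] linear_scale[OF lin] inner_add_left inner_add_right
          \<mu>_def algebra_simps)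
    have id: "(v + t *\<^sub>R w) \<bullet> (v + t *\<^sub>R w) = 1 + 2 * t * (w \<bullet> v) + t * t * (w \<bullet> w)"
      using vv by (simp add: inner_add_left inner_add_right algebra_simps inner_commute)
    have "w \<bullet> w = w \<bullet> (f v - \<mu> *\<^sub>R v)" by (simp add: w_def)
    then have p: "p = 2 * (w \<bullet> f v - \<mu> * (w \<bullet> v))" by (simp add: p_def inner_diff_right)
    then show ?thesis using le unfolding f id q_def p by (simp add: algebra_simps)
  qed
  have "p = 0"
  proof -
    \<comment> \<open>The exact minimiser \<open>p / (2 * q)\<close> is useless when
      \<open>q = 0\<close>; with \<open>q + 1\<close> in the denominator the value is minus a square
      for every \<open>q \<ge> 0\<close>.\<close>
    have "0 \<le> (p / (q + 1)) * (p / (q + 1)) * q - (p / (q + 1)) * p" by (rule quad)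
    also have "\<dots> = - (p / (q + 1))\<^sup>2"
      using q0 by (simp add: divide_simps power2_eq_square) (simp add: algebra_simps)
    finally show ?thesis using q0 by simp
  qed
  then have "w = 0" by (simp add: p_def)
  then show ?thesis using vW vn by (auto simp: w_def \<mu>_def)
qed

text \<open>Take an orthonormal set of eigenvectors of maximal cardinality, which exists because the
  dimension bounds its size. Self-adjointness makes its orthogonal complement invariant, so if it
  failed to span, the previous lemma would supply one more eigenvector.\<close>

lemma selfadjoint_orthonormal_eigenbasis:
  fixes f :: "'a::euclidean_space \<Rightarrow> 'a"
  assumes lin: "linear f" and sa: "\<And>u v. u \<bullet> f v = v \<bullet> f u"
  obtains B where "finite B" "pairwise orthogonal B" "span B = UNIV"
    "\<And>e. e \<in> B \<Longrightarrow> norm e = 1" "\<And>e. e \<in> B \<Longrightarrow> f e = (e \<bullet> f e) *\<^sub>R e"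
proof -
  define P where "P B \<longleftrightarrow> finite B \<and> pairwise orthogonal B
    \<and> (\<forall>e\<in>B. norm e = 1 \<and> f e = (e \<bullet> f e) *\<^sub>R e)" for B
  have card: "card B \<le> DIM('a)" if "P B" for B
  proof -
    have "0 \<notin> B" using that unfolding P_def by force
    then have "independent B" using that pairwise_orthogonal_independent unfolding P_def by blast
    then show ?thesis using independent_bound by blast
  qed
  have "P {}" by (simp add: P_def)
  then obtain B where B: "P B" and max: "\<And>C. P C \<Longrightarrow> card C \<le> card B"
    using ex_has_greatest_nat[of P "{}" card "Suc DIM('a)"] card by (metis less_Suc_eq_le)
  have eig: "f e = (e \<bullet> f e) *\<^sub>R e" if "e \<in> B" for e using B that by (simp add: P_def)
  have "span B = UNIV"
  proof (rule ccontr)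
    assume "span B \<noteq> UNIV"
    then have "span B \<subset> span UNIV" by auto
    then obtain u where u: "u \<noteq> 0" "\<And>v. v \<in> span B \<Longrightarrow> orthogonal u v"
      using orthogonal_to_subspace_exists_gen by blast
    define W where "W = {w. \<forall>e\<in>B. w \<bullet> e = 0}"
    have "subspace W" unfolding W_def subspace_def by (simp add: inner_simps)
    moreover have "f w \<in> W" if "w \<in> W" for w
      unfolding W_def
    proof (clarify)
      fix e assume e: "e \<in> B"
      have "f w \<bullet> e = w \<bullet> f e" using sa by (metis inner_commute)
      also have "\<dots> = (e \<bullet> f e) * (w \<bullet> e)" by (subst eig[OF e]) simp
      finally show "f w \<bullet> e = 0" using that e by (simp add: W_def)
    qed
    moreover have "u \<in> W" using u(2)[OF span_base] by (simp add: W_def orthogonal_def)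
    then have "W \<noteq> {0}" using u(1) by blast
    ultimately obtain v where v: "v \<in> W" "norm v = 1" "f v = (v \<bullet> f v) *\<^sub>R v"
      using selfadjoint_eigenvector_in_invariant_subspace[OF lin sa] by blast
    have "v \<notin> B" using v(1,2) by (auto simp: W_def)
    moreover have "P (insert v B)"
      using B v unfolding P_def
      by (auto simp: pairwise_insert orthogonal_def W_def inner_commute)
    ultimately show False using max[of "insert v B"] B by (simp add: P_def)
  qed
  then show ?thesis using that B unfolding P_def by blast
qed

text \<open>Parseval's identity. It reduces the construction of the square root and Kantorovich's
  inequality to scalar statements about single coordinates.\<close>

lemma inner_orthonormal_basis_sum:
  fixes B :: "'a::euclidean_space set"
  assumes "pairwise orthogonal B" "\<And>e. e \<in> B \<Longrightarrow> norm e = 1" "span B = UNIV" "finite B"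
  shows "u \<bullet> v = (\<Sum>e\<in>B. (e \<bullet> u) * (e \<bullet> v))"
proof -
  have "u \<bullet> v = (\<Sum>e\<in>B. (u \<bullet> e) *\<^sub>R e) \<bullet> v"
    by (subst orthonormal_basis_expand) (use assms in auto)
  then show ?thesis by (simp add: inner_sum_left inner_commute[of u])
qed

lemma inner_orthonormal_sum_left:
  fixes B :: "'a::real_inner set"
  assumes "finite B" "pairwise orthogonal B" "\<And>e. e \<in> B \<Longrightarrow> norm e = 1" "e \<in> B"
  shows "e \<bullet> (\<Sum>d\<in>B. h d *\<^sub>R d) = h e"
proof -
  have "e \<bullet> (\<Sum>d\<in>B. h d *\<^sub>R d) = (\<Sum>d\<in>B. if d = e then h e else 0)"
    unfolding inner_sum_right
    using assms by (intro sum.cong) (auto simp: norm_eq_1 pairwise_def orthogonal_def)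
  then show ?thesis using assms by simp
qed

lemma symmetric_matrixI:
  fixes M :: "real^'n^'n"
  assumes "\<And>u v. u \<bullet> (M *v v) = v \<bullet> (M *v u)"
  shows "transpose M = M"
proof -
  have "u \<bullet> (transpose M *v v) = u \<bullet> (M *v v)" for u v
    using assms[of u v] by (metis dot_lmul_matrix inner_commute transpose_matrix_vector)
  then have "transpose M *v v = M *v v" for v using vector_eq_ldot by blast
  then show ?thesis by (simp add: matrix_eq)
qed

text \<open>Symmetry moves \<open>A\<close> onto the basis vector, which gives the last conclusion:
  in eigencoordinates \<open>A\<close> acts by scalar multiplication.\<close>

lemma symmetric_eigenbasis:
  fixes A :: "real^'n^'n"
  assumes "transpose A = A"
  obtains B \<mu> where "finite B" "pairwise orthogonal B" "span B = UNIV"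
    "\<And>e. e \<in> B \<Longrightarrow> norm e = 1" "\<And>e. e \<in> B \<Longrightarrow> A *v e = \<mu> e *\<^sub>R e"
    "\<And>e. e \<in> B \<Longrightarrow> eigenvalue A (\<mu> e)" "\<And>e v. e \<in> B \<Longrightarrow> e \<bullet> (A *v v) = \<mu> e * (e \<bullet> v)"
proof -
  obtain B where B: "finite B" "pairwise orthogonal B" "span B = UNIV"
    "\<And>e. e \<in> B \<Longrightarrow> norm e = 1" "\<And>e. e \<in> B \<Longrightarrow> A *v e = (e \<bullet> (A *v e)) *\<^sub>R e"
    using selfadjoint_orthonormal_eigenbasis[OF matrix_vector_mul_linear sym_inner_commute[OF assms]]
    by blast
  show ?thesis
  proof (rule that[OF B])
    fix e assume e: "e \<in> B"
    then show "eigenvalue A (e \<bullet> (A *v e))"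
      using B(4,5)[OF e] unfolding eigenvalue_def by (metis norm_zero zero_neq_one)
    fix v
    have "e \<bullet> (A *v v) = v \<bullet> (A *v e)" by (rule sym_inner_commute[OF assms])
    also have "\<dots> = (e \<bullet> (A *v e)) * (e \<bullet> v)"
      by (subst B(5)[OF e]) (simp add: inner_commute)
    finally show "e \<bullet> (A *v v) = (e \<bullet> (A *v e)) * (e \<bullet> v)" .
  qed
qed

section \<open>The positive definite square root\<close>

lemma sym_pos_def_eigenvalue_pos:
  assumes "sym_pos_def A" "eigenvalue A \<mu>"
  shows "0 < \<mu>"
proof -
  obtain v where v: "v \<noteq> 0" "A *v v = \<mu> *\<^sub>R v" using assms(2) by (auto simp: eigenvalue_def)
  then have "0 < \<mu> * (v \<bullet> v)" using assms(1) unfolding sym_pos_def_def by force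
  moreover have "0 < v \<bullet> v" using v(1) by simp
  ultimately show ?thesis by (rule zero_less_mult_pos2)
qed

text \<open>Scale each eigencoordinate by the positive root of its eigenvalue. Diagonality gives
  symmetry, positive factors give definiteness, and applying the map twice restores the
  eigenvalues.\<close>

lemma sym_pos_def_sqrt_exists:
  fixes A :: "real^'n^'n"
  assumes "sym_pos_def A"
  shows "\<exists>S. sym_pos_def S \<and> S ** S = A"
proof -
  have "transpose A = A" using assms by (simp add: sym_pos_def_def)
  then obtain B \<mu> where B: "finite B" "pairwise orthogonal B" "span B = UNIV"
    "\<And>e. e \<in> B \<Longrightarrow> norm e = 1" and ev: "\<And>e. e \<in> B \<Longrightarrow> eigenvalue A (\<mu> e)"
    and coord: "\<And>e v. e \<in> B \<Longrightarrow> e \<bullet> (A *v v) = \<mu> e * (e \<bullet> v)"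
    using symmetric_eigenbasis by metis
  have pos: "\<mu> e > 0" if "e \<in> B" for e using sym_pos_def_eigenvalue_pos[OF assms ev[OF that]] .
  have ip: "u \<bullet> v = (\<Sum>e\<in>B. (e \<bullet> u) * (e \<bullet> v))" for u v
    using B by (intro inner_orthonormal_basis_sum)
  define f where "f v = (\<Sum>e\<in>B. (sqrt (\<mu> e) * (e \<bullet> v)) *\<^sub>R e)" for v
  have "linear f" unfolding f_def
    by (intro linear_compose_sum ballI linearI) (simp_all add: inner_simps algebra_simps)
  define S where "S = matrix f"
  have S: "S *v v = f v" for v unfolding S_def 
    by (rule matrix_works) (simp add: linear_matrix_vector_mul_eq \<open>linear f\<close>)
  have Sc: "e \<bullet> (S *v v) = sqrt (\<mu> e) * (e \<bullet> v)" if "e \<in> B" for e v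
    unfolding S f_def by (rule inner_orthonormal_sum_left[OF B(1,2,4) that])
  have form: "u \<bullet> (S *v v) = (\<Sum>e\<in>B. sqrt (\<mu> e) * ((e \<bullet> u) * (e \<bullet> v)))" for u v
    unfolding ip[of u "S *v v"] by (rule sum.cong) (simp_all add: Sc)
  have "transpose S = S"
  proof (rule symmetric_matrixI)
    fix u v
    show "u \<bullet> (S *v v) = v \<bullet> (S *v u)" unfolding form by (simp only: mult.commute)
  qed
  moreover have "0 < v \<bullet> (S *v v)" if "v \<noteq> 0" for v
  proof -
    have "\<exists>e\<in>B. e \<bullet> v \<noteq> 0"
    proof (rule ccontr)
      assume "\<not> (\<exists>e\<in>B. e \<bullet> v \<noteq> 0)"
      then have "v \<bullet> v = 0" using ip[of v v] by simp
      then show False using that by simp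
    qed
    then obtain e where e: "e \<in> B" "e \<bullet> v \<noteq> 0" by blast
    show ?thesis
      unfolding form
    proof (rule sum_pos2[OF B(1) e(1)])
      show "0 < sqrt (\<mu> e) * ((e \<bullet> v) * (e \<bullet> v))"
        using pos[OF e(1)] e(2) by (simp add: zero_less_mult_iff) argo
      show "0 \<le> sqrt (\<mu> d) * ((d \<bullet> v) * (d \<bullet> v))" if "d \<in> B" for d
        using pos[OF that] by simp
    qed
  qed
  moreover have "S ** S = A"
  proof -
    have "u \<bullet> (S *v (S *v v)) = u \<bullet> (A *v v)" for u v
      unfolding form[of u "S *v v"] ip[of u "A *v v"]
    proof (rule sum.cong)
      fix e assume e: "e \<in> B"
      have "sqrt (\<mu> e) * sqrt (\<mu> e) = \<mu> e" using pos[OF e] by simp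
      then show "sqrt (\<mu> e) * ((e \<bullet> u) * (e \<bullet> (S *v v))) = (e \<bullet> u) * (e \<bullet> (A *v v))"
        unfolding Sc[OF e] coord[OF e] by (metis mult.assoc mult.commute)
    qed simp
    then have "S *v (S *v v) = A *v v" for v using vector_eq_ldot by blast
    then show ?thesis by (simp add: matrix_eq matrix_vector_mul_assoc)
  qed
  ultimately show ?thesis unfolding sym_pos_def_def by blast
qed

text \<open>The two maps are compared on an eigenbasis of \<open>S\<close> alone: each of its
  vectors turns out to be an eigenvector of \<open>T\<close> for the same eigenvalue.\<close>

lemma sym_pos_def_sqrt_unique:
  fixes S T :: "real^'n^'n"
  assumes S: "sym_pos_def S" and T: "sym_pos_def T" and eq: "S ** S = T ** T"
  shows "S = T"
proof -
  have "transpose S = S" using S by (simp add: sym_pos_def_def)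
  then obtain B \<mu> where B: "span B = UNIV"
    and eig: "\<And>e. e \<in> B \<Longrightarrow> S *v e = \<mu> e *\<^sub>R e"
    and ev: "\<And>e. e \<in> B \<Longrightarrow> eigenvalue S (\<mu> e)"
    using symmetric_eigenbasis by metis
  have "S *v e = T *v e" if e: "e \<in> B" for e
  proof -
    have pos: "\<mu> e > 0" using sym_pos_def_eigenvalue_pos[OF S ev[OF e]] .
    define d where "d = T *v e - \<mu> e *\<^sub>R e"
    have "T *v (T *v e) = \<mu> e *\<^sub>R \<mu> e *\<^sub>R e"
      using eq by (metis eig[OF e] matrix_vector_mul_assoc matrix_vector_mult_scaleR)
    \<comment> \<open>\<open>(T + \<mu>) (T - \<mu>) e = 0\<close>, and \<open>T + \<mu>\<close> is positive definite.\<close>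
    then have "T *v d = - (\<mu> e *\<^sub>R d)"
      unfolding d_def by (simp add: matrix_vector_mult_diff_distrib matrix_vector_mult_scaleR
          scaleR_diff_right)
    then have "d \<bullet> (T *v d) = - (\<mu> e * (d \<bullet> d))" by simp
    moreover have "0 \<le> \<mu> e * (d \<bullet> d)" using pos by simp
    ultimately have "d = 0" using T unfolding sym_pos_def_def by (metis neg_le_0_iff_le not_less)
    then show ?thesis by (simp add: d_def eig[OF e])
  qed
  then have "S *v v = T *v v" for v
    using linear_eq_on_span[OF matrix_vector_mul_linear matrix_vector_mul_linear, of B S T v] B
    by simp
  then show ?thesis by (simp add: matrix_eq)
qed

text \<open>Existence and uniqueness discharge the definite description; later arguments about the
  root use only these two properties.\<close>

lemma mat_sqrt:
  assumes "sym_pos_def A"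
  shows "sym_pos_def (mat_sqrt A)" "mat_sqrt A ** mat_sqrt A = A"
proof -
  have "\<exists>!S. sym_pos_def S \<and> S ** S = A"
    using sym_pos_def_sqrt_exists[OF assms] sym_pos_def_sqrt_unique by metis
  from theI'[OF this] show "sym_pos_def (mat_sqrt A)" "mat_sqrt A ** mat_sqrt A = A"
    by (simp_all add: mat_sqrt_def)
qed

section \<open>Integer and half-integer matrix powers\<close>

lemma mat_pow_commute:
  assumes "A ** C = C ** A"
  shows "mat_pow A m ** C = C ** mat_pow A m"
proof (induction m)
  case (Suc m)
  have "A ** mat_pow A m ** C = A ** (C ** mat_pow A m)"
    by (simp only: Suc flip: matrix_mul_assoc)
  also have "\<dots> = C ** (A ** mat_pow A m)" by (simp only: assms matrix_mul_assoc)
  finally show ?case by simp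
qed simp

lemma mat_pow_add: "mat_pow A (m + k) = mat_pow A m ** mat_pow A k"
  by (induction m) (simp_all add: matrix_mul_assoc)

text \<open>Applied to the square root of a matrix, this shows that the odd half-integer powers
  square to ordinary powers.\<close>

lemma mat_pow_square: "mat_pow (A ** A) m = mat_pow A m ** mat_pow A m"
proof (induction m)
  case (Suc m)
  have "A ** A ** (mat_pow A m ** mat_pow A m) = A ** (A ** mat_pow A m) ** mat_pow A m"
    by (simp add: matrix_mul_assoc)
  also have "A ** mat_pow A m = mat_pow A m ** A" by (rule mat_pow_commute[OF refl, symmetric])
  finally show ?case using Suc by (simp add: matrix_mul_assoc)
qed simp

lemma transpose_mat_pow:
  fixes A :: "real^'n^'n"
  assumes "transpose A = A"
  shows "transpose (mat_pow A m) = mat_pow A m"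
  using assms
  by (induction m) (simp_all add: matrix_transpose_mul mat_pow_commute[OF refl])

lemma mat_hpow_of_int: "mat_hpow A (of_int j) = mat_powi A j"
  by (simp add: mat_hpow_def)

text \<open>The parity of \<open>m\<close> decides which branch of \<open>mat_hpow\<close> applies.
  These three facts are all that the convergence proof uses about the \<open>l\<close>-th power, so
  integer and half-integer \<open>l\<close> are treated alike afterwards.\<close>

lemma mat_hpow_half:
  fixes A :: "real^'n^'n" and m :: nat
  assumes "sym_pos_def A"
  defines "M \<equiv> mat_hpow A (real m / 2)"
  shows "transpose M = M" "M ** M = mat_pow A m" "M ** A = A ** M"
proof -
  have sym: "transpose A = A" using assms(1) by (simp add: sym_pos_def_def)
  have "transpose M = M \<and> M ** M = mat_pow A m \<and> M ** A = A ** M"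
  proof (cases "even m")
    case True
    then obtain k where k: "m = 2 * k" by (elim evenE)
    have "M = mat_pow A k"
      using mat_hpow_of_int[of A "int k"] by (simp add: M_def k mat_powi_def)
    then show ?thesis
      using sym by (simp add: transpose_mat_pow mat_pow_commute[OF refl] k mult_2 mat_pow_add)
  next
    case False
    have "real m / 2 \<notin> \<int>"
    proof
      assume "real m / 2 \<in> \<int>"
      then obtain j where "real m / 2 = of_int j" by (elim Ints_cases)
      then have "int m = 2 * j" by linarith
      then show False using False by presburger
    qed
    then have M: "M = mat_pow (mat_sqrt A) m"
      by (simp add: M_def mat_hpow_def mat_powi_def)
    note S = mat_sqrt[OF assms(1)]
    have "M ** M = mat_pow A m"
      using mat_pow_square[of "mat_sqrt A" m] by (simp add: M S(2))
    moreover have "M ** A = A ** M"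
    proof -
      \<comment> \<open>Both sides are the cube of the root, bracketed in two ways.\<close>
      have "mat_sqrt A ** A = A ** mat_sqrt A"
        using matrix_mul_assoc[of "mat_sqrt A" "mat_sqrt A" "mat_sqrt A"] by (simp only: S(2))
      then show ?thesis unfolding M by (rule mat_pow_commute)
    qed
    moreover have "transpose M = M"
      unfolding M using S(1) by (intro transpose_mat_pow) (simp add: sym_pos_def_def)
    ultimately show ?thesis by blast
  qed
  then show "transpose M = M" "M ** M = mat_pow A m" "M ** A = A ** M" by blast+
qed

lemma sym_pos_def_matrix_inv:
  fixes A :: "real^'n^'n"
  assumes "sym_pos_def A"
  shows "A ** matrix_inv A = mat 1" "matrix_inv A ** A = mat 1"
proof -
  have "v = 0" if "A *v v = 0" for v
    using assms that unfolding sym_pos_def_def by (metis inner_zero_right less_irrefl)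
  then have "invertible A"
    by (simp add: invertible_left_inverse matrix_left_invertible_ker)
  then show "A ** matrix_inv A = mat 1" "matrix_inv A ** A = mat 1"
    unfolding matrix_inv_def invertible_def by (metis (mono_tags, lifting) someI_ex)+
qed

text \<open>The product form covers \<open>m = 0\<close> uniformly, where the power is the inverse
  of \<open>A\<close>; this is the case \<open>l = 0\<close> of the exponent
  \<open>2 * l - 1\<close>.\<close>

lemma mat_powi_pred_mult:
  fixes A :: "real^'n^'n"
  assumes "sym_pos_def A"
  shows "mat_powi A (int m - 1) ** A = mat_pow A m"
proof (cases m)
  case 0
  then show ?thesis by (simp add: mat_powi_def sym_pos_def_matrix_inv[OF assms])
next
  case (Suc k)
  then show ?thesis by (simp add: mat_powi_def mat_pow_commute[OF refl])
qed

section \<open>Kantorovich's inequality\<close>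

text \<open>The sum form of Kantorovich's inequality, with \<open>z = A\<^sup>-\<^sup>1 y\<close>: on each eigenvector it
  reads \<open>\<mu> (lam1 - \<mu>) (\<mu> - lamn) \<ge> 0\<close>.\<close>
lemma kantorovich_sum:
  fixes A :: "real^'n^'n"
  assumes A: "sym_pos_def A"
    and le: "\<And>\<mu>. eigenvalue A \<mu> \<Longrightarrow> \<mu> \<le> lam1" and ge: "\<And>\<mu>. eigenvalue A \<mu> \<Longrightarrow> lamn \<le> \<mu>"
    and y: "y = A *v z"
  shows "y \<bullet> (A *v y) + lam1 * lamn * (z \<bullet> y) \<le> (lam1 + lamn) * (y \<bullet> y)"
proof -
  have "transpose A = A" using A by (simp add: sym_pos_def_def)
  then obtain B \<mu> where B: "finite B" "pairwise orthogonal B" "span B = UNIV"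
    "\<And>e. e \<in> B \<Longrightarrow> norm e = 1" and ev: "\<And>e. e \<in> B \<Longrightarrow> eigenvalue A (\<mu> e)"
    and coord: "\<And>e v. e \<in> B \<Longrightarrow> e \<bullet> (A *v v) = \<mu> e * (e \<bullet> v)"
    using symmetric_eigenbasis by metis
  have ip: "u \<bullet> v = (\<Sum>e\<in>B. (e \<bullet> u) * (e \<bullet> v))" for u v
    using B by (intro inner_orthonormal_basis_sum)
  have "(lam1 + lamn) * (y \<bullet> y) - y \<bullet> (A *v y) - lam1 * lamn * (z \<bullet> y)
      = (\<Sum>e\<in>B. (lam1 + lamn) * ((e \<bullet> y) * (e \<bullet> y)) - (e \<bullet> y) * (e \<bullet> (A *v y))
          - lam1 * lamn * ((e \<bullet> z) * (e \<bullet> y)))"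
    unfolding ip[of y y] ip[of y "A *v y"] ip[of z y] by (simp add: sum_subtractf sum_distrib_left)
  also have "\<dots> = (\<Sum>e\<in>B. (e \<bullet> z)\<^sup>2 * (\<mu> e * ((lam1 - \<mu> e) * (\<mu> e - lamn))))"
    by (rule sum.cong) (simp_all add: y coord power2_eq_square algebra_simps)
  also have "\<dots> \<ge> 0"
  proof (rule sum_nonneg)
    fix e assume e: "e \<in> B"
    show "0 \<le> (e \<bullet> z)\<^sup>2 * (\<mu> e * ((lam1 - \<mu> e) * (\<mu> e - lamn)))"
      using le[OF ev[OF e]] ge[OF ev[OF e]] sym_pos_def_eigenvalue_pos[OF A ev[OF e]] by simp
  qed
  finally show ?thesis by (simp add: algebra_simps)
qed

text \<open>The sum form bounds \<open>?p + ?q\<close>, and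
  \<open>4 * (?p * ?q) \<le> (?p + ?q)\<^sup>2\<close> turns this into a bound on the product.
  Writing \<open>y = A *v z\<close> expresses the inverse quadratic form at \<open>y\<close> as
  \<open>z \<bullet> y\<close>.\<close>

lemma kantorovich:
  fixes A :: "real^'n^'n"
  assumes "sym_pos_def A"
    and "\<And>\<mu>. eigenvalue A \<mu> \<Longrightarrow> \<mu> \<le> lam1" and "\<And>\<mu>. eigenvalue A \<mu> \<Longrightarrow> lamn \<le> \<mu>"
    and pos: "0 < lam1" "0 < lamn"
    and y: "y = A *v z"
  shows "4 * lam1 * lamn / (lam1 + lamn)\<^sup>2 * (z \<bullet> y) * (y \<bullet> (A *v y)) \<le> (y \<bullet> y)\<^sup>2"
proof -
  have psd: "0 \<le> v \<bullet> (A *v v)" for v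
    using assms(1) unfolding sym_pos_def_def by (cases "v = 0") (auto simp: less_imp_le)
  let ?p = "y \<bullet> (A *v y)" and ?q = "lam1 * lamn * (z \<bullet> y)"
  have nn: "0 \<le> ?p" "0 \<le> ?q" using psd[of y] psd[of z] pos y by simp_all
  have "4 * (?p * ?q) \<le> (?p + ?q)\<^sup>2"
    using zero_le_power2[of "?p - ?q"] by (simp add: power2_eq_square algebra_simps)
  also have "\<dots> \<le> ((lam1 + lamn) * (y \<bullet> y))\<^sup>2"
    using kantorovich_sum[OF assms(1-3) y] nn by (intro power_mono) auto
  finally have "4 * (?p * ?q) \<le> (y \<bullet> y)\<^sup>2 * (lam1 + lamn)\<^sup>2"
    by (simp only: power_mult_distrib mult.commute)
  moreover have "0 < (lam1 + lamn)\<^sup>2" using pos by simp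
  ultimately have "4 * (?p * ?q) / (lam1 + lamn)\<^sup>2 \<le> (y \<bullet> y)\<^sup>2"
    by (simp only: pos_divide_le_eq)
  then show ?thesis by (simp only: times_divide_eq_left times_divide_eq_right mult_ac)
qed

section \<open>Contraction in one step\<close>

text \<open>For \<open>y = 0\<close> the quotient is \<open>0/0 = 0\<close>, and both sides vanish.\<close>
lemma relaxed_step_contraction:
  fixes A :: "real^'n^'n"
  assumes A: "sym_pos_def A"
    and "\<And>\<mu>. eigenvalue A \<mu> \<Longrightarrow> \<mu> \<le> lam1" and "\<And>\<mu>. eigenvalue A \<mu> \<Longrightarrow> lamn \<le> \<mu>"
    and "0 < lam1" "0 < lamn" and \<omega>: "0 < \<omega>" "\<omega> < 2"
    and y: "y = A *v z" and z': "z' = z - (\<omega> * ((y \<bullet> y) / (y \<bullet> (A *v y)))) *\<^sub>R y"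
  shows "z' \<bullet> (A *v z')
    \<le> (1 - \<omega> * (2 - \<omega>) * (4 * lam1 * lamn / (lam1 + lamn)\<^sup>2)) * (z \<bullet> (A *v z))"
proof (cases "y = 0")
  case True
  then have "A *v z = 0" "z' = z" using y z' by simp_all
  then show ?thesis by simp
next
  case False
  let ?K = "4 * lam1 * lamn / (lam1 + lamn)\<^sup>2" and ?p = "y \<bullet> (A *v y)"
  have sym: "transpose A = A" and p: "0 < ?p" using A False by (auto simp: sym_pos_def_def)
  \<comment> \<open>\<open>r\<close> is the unrelaxed step length. Trading
    \<open>y \<bullet> y\<close> for \<open>r * ?p\<close> leaves only \<open>z \<bullet> y\<close>,
    \<open>r\<close> and \<open>?p\<close>, and lets one factor \<open>?p\<close> cancel in
    Kantorovich's inequality.\<close>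
  define r where "r = (y \<bullet> y) / ?p"
  have r: "y \<bullet> y = r * ?p" using p by (simp add: r_def)
  have zAz: "z \<bullet> (A *v z) = z \<bullet> y" by (simp add: y)
  have "?K * (z \<bullet> y) * ?p \<le> (r * r * ?p) * ?p"
    using kantorovich[OF assms(1-5) y] unfolding r by (simp only: power2_eq_square mult_ac)
  then have K: "?K * (z \<bullet> y) \<le> r * r * ?p" using p by (rule mult_right_le_imp_le)
  have zAy: "z \<bullet> (A *v y) = r * ?p" using sym_inner_commute[OF sym, of z y] r by (simp flip: y)
  have Az': "A *v z' = y - (\<omega> * r) *\<^sub>R (A *v y)"
    unfolding z' r_def[symmetric]
    by (simp only: matrix_vector_mult_diff_distrib matrix_vector_mult_scaleR y)
  have "z' \<bullet> (A *v z') = z \<bullet> y - \<omega> * r * (z \<bullet> (A *v y)) - \<omega> * r * (y \<bullet> y)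
      + (\<omega> * r) * (\<omega> * r) * ?p"
    unfolding Az' unfolding z' r_def[symmetric]
    by (simp add: inner_diff_left inner_diff_right algebra_simps)
  \<comment> \<open>By symmetry \<open>z \<bullet> (A *v y)\<close> equals
    \<open>y \<bullet> y\<close>, so the two linear terms coincide and combine with the quadratic
    one into the factor \<open>\<omega> * (2 - \<omega>)\<close>.\<close>
  also have "\<dots> = z \<bullet> y - \<omega> * (2 - \<omega>) * (r * r * ?p)"
    unfolding zAy r by (simp add: algebra_simps)
  also have "\<dots> \<le> z \<bullet> y - \<omega> * (2 - \<omega>) * (?K * (z \<bullet> y))"
    using K \<omega> by (intro diff_left_mono mult_left_mono) simp_all
  also have "\<dots> = (1 - \<omega> * (2 - \<omega>) * ?K) * (z \<bullet> (A *v z))"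
    unfolding zAz by (simp only: left_diff_distrib mult_1 mult.assoc)
  finally show ?thesis .
qed

text \<open>Iterating the contraction multiplies an inequality by the rate, so its sign matters. The
  two factors of the subtracted term are at most 1 because \<open>(lam1 - lamn)\<^sup>2\<close> and
  \<open>(\<omega> - 1)\<^sup>2\<close> are nonnegative.\<close>

lemma relaxed_rate_nonneg:
  fixes lam1 lamn \<omega> :: real
  assumes "0 < lam1" "0 < lamn" "0 < \<omega>" "\<omega> < 2"
  shows "0 \<le> 1 - \<omega> * (2 - \<omega>) * (4 * lam1 * lamn / (lam1 + lamn)\<^sup>2)"
proof -
  have "4 * lam1 * lamn / (lam1 + lamn)\<^sup>2 \<le> 1"
  proof -
    have "4 * lam1 * lamn \<le> (lam1 + lamn)\<^sup>2"
      using zero_le_power2[of "lam1 - lamn"] by (simp add: power2_eq_square algebra_simps)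
    then show ?thesis using assms by (simp add: divide_le_eq_1)
  qed
  moreover have "\<omega> * (2 - \<omega>) \<le> 1"
    using zero_le_power2[of "\<omega> - 1"] by (simp add: power2_eq_square algebra_simps)
  ultimately have "\<omega> * (2 - \<omega>) * (4 * lam1 * lamn / (lam1 + lamn)\<^sup>2) \<le> 1 * 1"
    using assms by (intro mult_mono) auto
  then show ?thesis by simp
qed

section \<open>Convergence of the iterates\<close>

theorem theorem8:
  fixes A :: "real^'n^'n"
    and b xstar :: "real^'n"
    and lam1 lamn l \<omega> :: real
    and x g y :: "nat \<Rightarrow> real^'n"
    and \<alpha> :: "nat \<Rightarrow> real"
    and c :: "real \<Rightarrow> real"
  assumes "sym_pos_def A"
    and "eigenvalue A lam1" and "\<And>\<mu>. eigenvalue A \<mu> \<Longrightarrow> \<mu> \<le> lam1"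
    and "eigenvalue A lamn" and "\<And>\<mu>. eigenvalue A \<mu> \<Longrightarrow> lamn \<le> \<mu>"
    and "is_arg_min (quad_obj A b) (\<lambda>_. True) xstar"
    and "\<exists>m::nat. l = real m / 2"
    and "0 < \<omega>" and "\<omega> < 2"
    and "\<And>k. g k = A *v x k - b"
    and "\<And>k. y k = mat_hpow A l *v g k"
    and "\<And>k. \<alpha> k = (if g k = 0 then 0 else (y k \<bullet> y k) / (y k \<bullet> (A *v y k)))"
    and "\<And>k. x (Suc k) = x k - (\<omega> * \<alpha> k) *\<^sub>R g k"
    and "\<And>w. c w = 1 - w * (2 - w) * (4 * lam1 * lamn / (lam1 + lamn)\<^sup>2)"
  shows "\<forall>k.
      (mat_norm (mat_hpow A (2 * l - 1)) (g k))\<^sup>2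
        \<le> c \<omega> ^ k * (mat_norm (mat_hpow A (2 * l - 1)) (g 0))\<^sup>2
    \<and> (mat_norm (mat_hpow A (2 * l + 1)) (x k - xstar))\<^sup>2
        \<le> c \<omega> ^ k * (mat_norm (mat_hpow A (2 * l + 1)) (x 0 - xstar))\<^sup>2
    \<and> (mat_norm (mat_hpow A (- 1)) (y k))\<^sup>2
        \<le> c \<omega> ^ k * (mat_norm (mat_hpow A (- 1)) (y 0))\<^sup>2"
proof -
  note A = assms(1)
  have sym: "transpose A = A" using A by (simp add: sym_pos_def_def)
  note inv = sym_pos_def_matrix_inv[OF A]
  have pos: "0 < lam1" "0 < lamn" using sym_pos_def_eigenvalue_pos[OF A] assms(2,4) by blast+
  obtain m where l: "l = real m / 2" using assms(7) by blast
  define M where "M = mat_hpow A l"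
  have M: "transpose M = M" "M ** M = mat_pow A m" "M ** A = A ** M"
    unfolding M_def l by (rule mat_hpow_half[OF A])+
  have MA: "M *v (A *v v) = A *v (M *v v)" for v
    by (simp add: matrix_vector_mul_assoc M(3))
  have xs: "A *v xstar = b"
    using assms(6) is_arg_min_quad_obj_iff[OF A, of b xstar]
    by (simp add: matrix_vector_mul_assoc inv(1))
  define e where "e k = x k - xstar" for k
  define z where "z k = M *v e k" for k
  have g: "g k = A *v e k" for k
    unfolding e_def assms(10) by (simp add: matrix_vector_mult_diff_distrib xs)
  have y: "y k = A *v z k" for k
    unfolding z_def assms(11) g M_def[symmetric] by (rule MA)
  define a where "a k = z k \<bullet> (A *v z k)" for k
  \<comment> \<open>One factor of \<open>M ** M\<close> is moved to each side of the inner
    product.\<close>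
  have powMM: "u \<bullet> (mat_pow A m *v v) = (M *v u) \<bullet> (M *v v)" for u v
    using sym_inner_commute[OF M(1), of u "M *v v"]
    by (simp add: M(2)[symmetric] inner_commute flip: matrix_vector_mul_assoc)
  \<comment> \<open>This lets the square cancel the square root in \<open>mat_norm\<close>.\<close>
  have psd: "0 \<le> a k" for k
    using A unfolding a_def sym_pos_def_def by (cases "z k = 0") (auto simp: less_imp_le)

  have n1: "(mat_norm (mat_hpow A (2 * l - 1)) (g k))\<^sup>2 = a k" for k
  proof -
    \<comment> \<open>Since \<open>2 * l = m\<close>, the exponent is the integer
      \<open>m - 1\<close>; the missing factor \<open>A\<close> comes from
      \<open>g k = A *v e k\<close>.\<close>
    have "mat_hpow A (2 * l - 1) *v g k = mat_pow A m *v e k"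
      using mat_hpow_of_int[of A "int m - 1"] mat_powi_pred_mult[OF A, of m]
      by (simp add: l g matrix_vector_mul_assoc)
    then have "g k \<bullet> (mat_hpow A (2 * l - 1) *v g k) = a k"
      by (simp add: powMM g MA a_def z_def inner_commute)
    then show ?thesis using psd by (simp add: mat_norm_def)
  qed
  have n2: "(mat_norm (mat_hpow A (2 * l + 1)) (x k - xstar))\<^sup>2 = a k" for k
  proof -
    have "mat_hpow A (2 * l + 1) = mat_pow A m ** A"
      using mat_hpow_of_int[of A "int m + 1"]
      by (simp add: l mat_powi_def nat_add_distrib mat_pow_commute[OF refl])
    then have "e k \<bullet> (mat_hpow A (2 * l + 1) *v e k) = a k"
      by (simp add: powMM MA a_def z_def flip: matrix_vector_mul_assoc)
    then show ?thesis using psd by (simp add: mat_norm_def flip: e_def)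
  qed
  have n3: "(mat_norm (mat_hpow A (- 1)) (y k))\<^sup>2 = a k" for k
  proof -
    have "mat_hpow A (- 1) *v y k = z k"
      using mat_hpow_of_int[of A "- 1"]
      by (simp add: mat_powi_def y matrix_vector_mul_assoc inv(2))
    then have "y k \<bullet> (mat_hpow A (- 1) *v y k) = a k"
      by (simp add: y a_def inner_commute)
    then show ?thesis using psd by (simp add: mat_norm_def)
  qed

  have step: "a (Suc k) \<le> c \<omega> * a k" for k
    unfolding a_def assms(14)
  proof (rule relaxed_step_contraction[OF A assms(3,5) pos assms(8,9) y])
    \<comment> \<open>At a stationary point the convention sets \<alpha> to 0, and there the
      quotient is \<open>0 / 0 = 0\<close> as well, so the case distinction disappears.\<close>
    have "y k = 0" if "g k = 0" using that by (simp add: assms(11))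
    then have "\<alpha> k = (y k \<bullet> y k) / (y k \<bullet> (A *v y k))" by (simp add: assms(12))
    \<comment> \<open>Applying \<open>M\<close> to the error recursion turns the direction
      \<open>g k\<close> into \<open>y k\<close>.\<close>
    then show "z (Suc k) = z k - (\<omega> * ((y k \<bullet> y k) / (y k \<bullet> (A *v y k)))) *\<^sub>R y k"
      by (simp add: z_def e_def assms(11,13) M_def matrix_vector_mult_diff_distrib
          matrix_vector_mult_scaleR)
  qed
  have c0: "0 \<le> c \<omega>" unfolding assms(14) by (rule relaxed_rate_nonneg[OF pos assms(8,9)])
  have "a k \<le> c \<omega> ^ k * a 0" for k
  proof (induction k)
    case (Suc k)
    have "a (Suc k) \<le> c \<omega> * (c \<omega> ^ k * a 0)"
      using step[of k] mult_left_mono[OF Suc c0] by linarith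
    then show ?case by (simp add: mult.assoc)
  qed simp
  then show ?thesis by (simp add: n1 n2 n3)
qed

end
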